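(* Assume $\neg\exists$-PEM, i.e. $\neg\forall a\in\mathbb{N}^{\mathbb{N}}\,(\exists n\,(a(n)=0)\vee\neg\exists n\,(a(n)=0))$. Then it is false that every oriented real $\alpha\in\mathbb{R}^o$ can be approximated by rationals.
   Context: Reasoning is in constructive (intuitionistic) logic. $\mathbb{R}^o$ (oriented reals) is the set of sequences $\alpha:\mathbb{N}\to\mathbb{Q}$ for which there is $M\in\mathbb{Q}$ with $\forall n(\alpha(n)<\alpha(n+1)<M)$. For $\alpha,\beta\in\mathbb{R}^o$: $\alpha\le\beta$ iff $\forall m\exists n(\alpha(m)<\beta(n))$; equality is $\alpha=^o\beta$ iff $\alpha\le\beta\wedge\beta\le\alpha$. For $q\in\mathbb{Q}$, $\hat q\in\mathbb{R}^o$ is $\hat q(n)=q-\frac1{n+1}$; $q\le\alpha$ means $\hat q\le\alpha$ and $\alpha\le q$ means $\alpha\le\hat q$. An oriented real $\alpha$ can be approximated by rationals if for each $n\in\mathbb{N}$ there exists $q\in\mathbb{Q}$ such that $q\le\alpha$ and $\alpha\le q+2^{-n}$. *)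

theory Defs
  imports Main
begin

text \<open>
  In HOL the principle of excluded middle is a theorem, so that a hypothesis of the form
  ``not PEM'' can only be studied inside an object logic. This theory sets up intuitionistic
  many-sorted first-order logic with a base theory of constructive analysis in the style of the
  system EL of Troelstra and van Dalen. The sorts are the natural numbers, the rational numbers
  (a discrete set with its usual field operations and order, as in Bishop-style mathematics),
  sequences of naturals and sequences of rationals. Sequences are closed under explicit definition
  and primitive recursion. No choice or comprehension principle, no continuity principle and no
  instance of excluded middle is assumed, apart from decidability of the order of the rationals.
  The base theory is a common part of classical, intuitionistic and recursive mathematics.
  It does not refute the negation of \<open>\<exists>\<close>-PEM, which is a consequence of Church's thesis.
  What is derivable here is derivable in every extension.
\<close>

datatype sort = Nat | Rat | NatSeq | RatSeq

section \<open>Terms\<close>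

text \<open>
  De Bruijn indices, counted separately for each sort: \<open>NVar i\<close> refers to the \<open>i\<close>-th enclosing
  binder of sort \<open>Nat\<close>, regardless of the binders of other sorts in between.

  \<open>NLam t\<close> is the sequence \<open>n \<mapsto> t\<close>, where \<open>NVar 0\<close> is \<open>n\<close> in \<open>t\<close>. \<open>NRec a b\<close> is the sequence
  with initial value \<open>a\<close> whose value at \<open>n + 1\<close> is \<open>b\<close>, where in \<open>b\<close> the index \<open>NVar 0\<close> is the
  value at \<open>n\<close> and \<open>NVar 1\<close> is \<open>n\<close>. In \<open>QRec a b\<close> the value at \<open>n\<close> is \<open>QVar 0\<close> and \<open>n\<close> is
  \<open>NVar 0\<close>.
\<close>

datatype nterm = NVar nat | Zero | Succ nterm | NApp nseq nterm
  and nseq = NSVar nat | NLam nterm | NRec nterm nterm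

datatype qterm = QVar nat | QOf nterm | QAdd qterm qterm | QNeg qterm | QMul qterm qterm
    | QInv qterm | QApp qseq nterm
  and qseq = QSVar nat | QLam qterm | QRec qterm qterm

abbreviation QSub :: "qterm \<Rightarrow> qterm \<Rightarrow> qterm" where
  "QSub x y \<equiv> QAdd x (QNeg y)"

abbreviation Q0 :: qterm where "Q0 \<equiv> QOf Zero"
abbreviation Q1 :: qterm where "Q1 \<equiv> QOf (Succ Zero)"
abbreviation Q2 :: qterm where "Q2 \<equiv> QOf (Succ (Succ Zero))"

section \<open>Formulas\<close>

datatype fm =
    Falsum  (\<open>\<^bold>\<bottom>\<close>)
  | NEq nterm nterm  (infix \<open>=\<^sub>N\<close> 50)
  | QEq qterm qterm  (infix \<open>=\<^sub>Q\<close> 50)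
  | QLess qterm qterm  (infix \<open><\<^sub>Q\<close> 50)
  | And fm fm  (infixr \<open>\<^bold>\<and>\<close> 35)
  | Or fm fm  (infixr \<open>\<^bold>\<or>\<close> 30)
  | Imp fm fm  (infixr \<open>\<^bold>\<longrightarrow>\<close> 25)
  | All sort fm
  | Ex sort fm

abbreviation Neg :: "fm \<Rightarrow> fm"  (\<open>\<^bold>\<not> _\<close> [40] 40) where
  "\<^bold>\<not> A \<equiv> A \<^bold>\<longrightarrow> \<^bold>\<bottom>"

section \<open>Renaming and substitution\<close>

type_synonym renaming = "sort \<Rightarrow> nat \<Rightarrow> nat"

definition up_ren :: "sort \<Rightarrow> renaming \<Rightarrow> renaming" where
  "up_ren s r = r(s := case_nat 0 (\<lambda>i. Suc (r s i)))"

definition weaken :: "sort \<Rightarrow> renaming" where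
  "weaken s = (\<lambda>_ i. i)(s := Suc)"

primrec ren_n :: "renaming \<Rightarrow> nterm \<Rightarrow> nterm" and ren_ns :: "renaming \<Rightarrow> nseq \<Rightarrow> nseq" where
  "ren_n r (NVar i) = NVar (r Nat i)"
| "ren_n r Zero = Zero"
| "ren_n r (Succ t) = Succ (ren_n r t)"
| "ren_n r (NApp f t) = NApp (ren_ns r f) (ren_n r t)"
| "ren_ns r (NSVar i) = NSVar (r NatSeq i)"
| "ren_ns r (NLam t) = NLam (ren_n (up_ren Nat r) t)"
| "ren_ns r (NRec a b) = NRec (ren_n r a) (ren_n (up_ren Nat (up_ren Nat r)) b)"

primrec ren_q :: "renaming \<Rightarrow> qterm \<Rightarrow> qterm" and ren_qs :: "renaming \<Rightarrow> qseq \<Rightarrow> qseq" where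
  "ren_q r (QVar i) = QVar (r Rat i)"
| "ren_q r (QOf t) = QOf (ren_n r t)"
| "ren_q r (QAdd x y) = QAdd (ren_q r x) (ren_q r y)"
| "ren_q r (QNeg x) = QNeg (ren_q r x)"
| "ren_q r (QMul x y) = QMul (ren_q r x) (ren_q r y)"
| "ren_q r (QInv x) = QInv (ren_q r x)"
| "ren_q r (QApp f t) = QApp (ren_qs r f) (ren_n r t)"
| "ren_qs r (QSVar i) = QSVar (r RatSeq i)"
| "ren_qs r (QLam x) = QLam (ren_q (up_ren Nat r) x)"
| "ren_qs r (QRec a b) = QRec (ren_q r a) (ren_q (up_ren Nat (up_ren Rat r)) b)"

primrec ren_fm :: "renaming \<Rightarrow> fm \<Rightarrow> fm" where
  "ren_fm r \<^bold>\<bottom> = \<^bold>\<bottom>"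
| "ren_fm r (s =\<^sub>N t) = (ren_n r s =\<^sub>N ren_n r t)"
| "ren_fm r (x =\<^sub>Q y) = (ren_q r x =\<^sub>Q ren_q r y)"
| "ren_fm r (x <\<^sub>Q y) = (ren_q r x <\<^sub>Q ren_q r y)"
| "ren_fm r (A \<^bold>\<and> B) = (ren_fm r A \<^bold>\<and> ren_fm r B)"
| "ren_fm r (A \<^bold>\<or> B) = (ren_fm r A \<^bold>\<or> ren_fm r B)"
| "ren_fm r (A \<^bold>\<longrightarrow> B) = (ren_fm r A \<^bold>\<longrightarrow> ren_fm r B)"
| "ren_fm r (All s A) = All s (ren_fm (up_ren s r) A)"
| "ren_fm r (Ex s A) = Ex s (ren_fm (up_ren s r) A)"

record substitution =
  sub_NVar :: "nat \<Rightarrow> nterm"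
  sub_QVar :: "nat \<Rightarrow> qterm"
  sub_NSVar :: "nat \<Rightarrow> nseq"
  sub_QSVar :: "nat \<Rightarrow> qseq"

datatype obj = NObj nterm | QObj qterm | NSObj nseq | QSObj qseq

primrec sort_of :: "obj \<Rightarrow> sort" where
  "sort_of (NObj _) = Nat"
| "sort_of (QObj _) = Rat"
| "sort_of (NSObj _) = NatSeq"
| "sort_of (QSObj _) = RatSeq"

primrec var0 :: "sort \<Rightarrow> obj" where
  "var0 Nat = NObj (NVar 0)"
| "var0 Rat = QObj (QVar 0)"
| "var0 NatSeq = NSObj (NSVar 0)"
| "var0 RatSeq = QSObj (QSVar 0)"

definition id_sub :: substitution where
  "id_sub = \<lparr>sub_NVar = NVar, sub_QVar = QVar, sub_NSVar = NSVar, sub_QSVar = QSVar\<rparr>"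

text \<open>\<open>bind u \<sigma>\<close> replaces index \<open>0\<close> of the sort of \<open>u\<close> by \<open>u\<close> and index \<open>i + 1\<close> of that sort as
  \<open>\<sigma>\<close> replaces index \<open>i\<close>.\<close>

primrec bind :: "obj \<Rightarrow> substitution \<Rightarrow> substitution" where
  "bind (NObj t) \<sigma> = \<sigma>\<lparr>sub_NVar := case_nat t (sub_NVar \<sigma>)\<rparr>"
| "bind (QObj x) \<sigma> = \<sigma>\<lparr>sub_QVar := case_nat x (sub_QVar \<sigma>)\<rparr>"
| "bind (NSObj f) \<sigma> = \<sigma>\<lparr>sub_NSVar := case_nat f (sub_NSVar \<sigma>)\<rparr>"
| "bind (QSObj f) \<sigma> = \<sigma>\<lparr>sub_QSVar := case_nat f (sub_QSVar \<sigma>)\<rparr>"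

definition weaken_sub :: "sort \<Rightarrow> substitution \<Rightarrow> substitution" where
  "weaken_sub s \<sigma> =
    \<lparr>sub_NVar = \<lambda>i. ren_n (weaken s) (sub_NVar \<sigma> i),
     sub_QVar = \<lambda>i. ren_q (weaken s) (sub_QVar \<sigma> i),
     sub_NSVar = \<lambda>i. ren_ns (weaken s) (sub_NSVar \<sigma> i),
     sub_QSVar = \<lambda>i. ren_qs (weaken s) (sub_QSVar \<sigma> i)\<rparr>"

definition up_sub :: "sort \<Rightarrow> substitution \<Rightarrow> substitution" where
  "up_sub s \<sigma> = bind (var0 s) (weaken_sub s \<sigma>)"

primrec sub_n :: "substitution \<Rightarrow> nterm \<Rightarrow> nterm" and sub_ns :: "substitution \<Rightarrow> nseq \<Rightarrow> nseq" where
  "sub_n \<sigma> (NVar i) = sub_NVar \<sigma> i"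
| "sub_n \<sigma> Zero = Zero"
| "sub_n \<sigma> (Succ t) = Succ (sub_n \<sigma> t)"
| "sub_n \<sigma> (NApp f t) = NApp (sub_ns \<sigma> f) (sub_n \<sigma> t)"
| "sub_ns \<sigma> (NSVar i) = sub_NSVar \<sigma> i"
| "sub_ns \<sigma> (NLam t) = NLam (sub_n (up_sub Nat \<sigma>) t)"
| "sub_ns \<sigma> (NRec a b) = NRec (sub_n \<sigma> a) (sub_n (up_sub Nat (up_sub Nat \<sigma>)) b)"

primrec sub_q :: "substitution \<Rightarrow> qterm \<Rightarrow> qterm" and sub_qs :: "substitution \<Rightarrow> qseq \<Rightarrow> qseq" where
  "sub_q \<sigma> (QVar i) = sub_QVar \<sigma> i"
| "sub_q \<sigma> (QOf t) = QOf (sub_n \<sigma> t)"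
| "sub_q \<sigma> (QAdd x y) = QAdd (sub_q \<sigma> x) (sub_q \<sigma> y)"
| "sub_q \<sigma> (QNeg x) = QNeg (sub_q \<sigma> x)"
| "sub_q \<sigma> (QMul x y) = QMul (sub_q \<sigma> x) (sub_q \<sigma> y)"
| "sub_q \<sigma> (QInv x) = QInv (sub_q \<sigma> x)"
| "sub_q \<sigma> (QApp f t) = QApp (sub_qs \<sigma> f) (sub_n \<sigma> t)"
| "sub_qs \<sigma> (QSVar i) = sub_QSVar \<sigma> i"
| "sub_qs \<sigma> (QLam x) = QLam (sub_q (up_sub Nat \<sigma>) x)"
| "sub_qs \<sigma> (QRec a b) = QRec (sub_q \<sigma> a) (sub_q (up_sub Nat (up_sub Rat \<sigma>)) b)"

primrec sub_fm :: "substitution \<Rightarrow> fm \<Rightarrow> fm" where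
  "sub_fm \<sigma> \<^bold>\<bottom> = \<^bold>\<bottom>"
| "sub_fm \<sigma> (s =\<^sub>N t) = (sub_n \<sigma> s =\<^sub>N sub_n \<sigma> t)"
| "sub_fm \<sigma> (x =\<^sub>Q y) = (sub_q \<sigma> x =\<^sub>Q sub_q \<sigma> y)"
| "sub_fm \<sigma> (x <\<^sub>Q y) = (sub_q \<sigma> x <\<^sub>Q sub_q \<sigma> y)"
| "sub_fm \<sigma> (A \<^bold>\<and> B) = (sub_fm \<sigma> A \<^bold>\<and> sub_fm \<sigma> B)"
| "sub_fm \<sigma> (A \<^bold>\<or> B) = (sub_fm \<sigma> A \<^bold>\<or> sub_fm \<sigma> B)"
| "sub_fm \<sigma> (A \<^bold>\<longrightarrow> B) = (sub_fm \<sigma> A \<^bold>\<longrightarrow> sub_fm \<sigma> B)"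
| "sub_fm \<sigma> (All s A) = All s (sub_fm (up_sub s \<sigma>) A)"
| "sub_fm \<sigma> (Ex s A) = Ex s (sub_fm (up_sub s \<sigma>) A)"

definition inst :: "obj \<Rightarrow> fm \<Rightarrow> fm" where
  "inst u A = sub_fm (bind u id_sub) A"

text \<open>\<open>A(n)\<close> becomes \<open>A(n + 1)\<close>, with \<open>n\<close> the variable \<open>NVar 0\<close>.\<close>

definition inst_Succ :: "fm \<Rightarrow> fm" where
  "inst_Succ A = sub_fm (bind (NObj (Succ (NVar 0))) (weaken_sub Nat id_sub)) A"

section \<open>The base theory\<close>

inductive axiom :: "fm \<Rightarrow> bool" where
  NEq_refl: "axiom (t =\<^sub>N t)"
| NEq_subst: "axiom (s =\<^sub>N t \<^bold>\<longrightarrow> inst (NObj s) A \<^bold>\<longrightarrow> inst (NObj t) A)"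
| QEq_refl: "axiom (x =\<^sub>Q x)"
| QEq_subst: "axiom (x =\<^sub>Q y \<^bold>\<longrightarrow> inst (QObj x) A \<^bold>\<longrightarrow> inst (QObj y) A)"
| Succ_neq_Zero: "axiom (\<^bold>\<not> (Succ t =\<^sub>N Zero))"
| Succ_inject: "axiom (Succ s =\<^sub>N Succ t \<^bold>\<longrightarrow> s =\<^sub>N t)"
| induction: "axiom (inst (NObj Zero) A \<^bold>\<longrightarrow> All Nat (A \<^bold>\<longrightarrow> inst_Succ A) \<^bold>\<longrightarrow> All Nat A)"
| NLam: "axiom (NApp (NLam s) t =\<^sub>N sub_n (bind (NObj t) id_sub) s)"
| NRec_Zero: "axiom (NApp (NRec a b) Zero =\<^sub>N a)"
| NRec_Succ: "axiom (NApp (NRec a b) (Succ t) =\<^sub>N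
    sub_n (bind (NObj (NApp (NRec a b) t)) (bind (NObj t) id_sub)) b)"
| QLam: "axiom (QApp (QLam x) t =\<^sub>Q sub_q (bind (NObj t) id_sub) x)"
| QRec_Zero: "axiom (QApp (QRec x y) Zero =\<^sub>Q x)"
| QRec_Succ: "axiom (QApp (QRec x y) (Succ t) =\<^sub>Q
    sub_q (bind (QObj (QApp (QRec x y) t)) (bind (NObj t) id_sub)) y)"
| QOf_Succ: "axiom (QOf (Succ t) =\<^sub>Q QAdd (QOf t) Q1)"
| QAdd_assoc: "axiom (QAdd (QAdd x y) z =\<^sub>Q QAdd x (QAdd y z))"
| QAdd_commute: "axiom (QAdd x y =\<^sub>Q QAdd y x)"
| QAdd_Q0: "axiom (QAdd x Q0 =\<^sub>Q x)"
| QAdd_QNeg: "axiom (QAdd x (QNeg x) =\<^sub>Q Q0)"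
| QMul_assoc: "axiom (QMul (QMul x y) z =\<^sub>Q QMul x (QMul y z))"
| QMul_commute: "axiom (QMul x y =\<^sub>Q QMul y x)"
| QMul_Q1: "axiom (QMul x Q1 =\<^sub>Q x)"
| QMul_QAdd: "axiom (QMul x (QAdd y z) =\<^sub>Q QAdd (QMul x y) (QMul x z))"
| QMul_QInv: "axiom (\<^bold>\<not> (x =\<^sub>Q Q0) \<^bold>\<longrightarrow> QMul x (QInv x) =\<^sub>Q Q1)"
| QInv_Q0: "axiom (QInv Q0 =\<^sub>Q Q0)"
| QLess_irrefl: "axiom (\<^bold>\<not> (x <\<^sub>Q x))"
| QLess_trans: "axiom (x <\<^sub>Q y \<^bold>\<longrightarrow> y <\<^sub>Q z \<^bold>\<longrightarrow> x <\<^sub>Q z)"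
| QLess_linear: "axiom (x <\<^sub>Q y \<^bold>\<or> x =\<^sub>Q y \<^bold>\<or> y <\<^sub>Q x)"
| Q0_less_Q1: "axiom (Q0 <\<^sub>Q Q1)"
| QAdd_mono: "axiom (x <\<^sub>Q y \<^bold>\<longrightarrow> QAdd x z <\<^sub>Q QAdd y z)"
| QMul_pos: "axiom (Q0 <\<^sub>Q x \<^bold>\<longrightarrow> Q0 <\<^sub>Q y \<^bold>\<longrightarrow> Q0 <\<^sub>Q QMul x y)"
  \<comment> \<open>every rational is of the form \<open>(k - l) / (m + 1)\<close>\<close>
| fraction: "axiom (All Rat (Ex Nat (Ex Nat (Ex Nat
    (QMul (QVar 0) (QOf (Succ (NVar 0))) =\<^sub>Q QSub (QOf (NVar 2)) (QOf (NVar 1)))))))"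

section \<open>Intuitionistic natural deduction\<close>

inductive derivable :: "fm list \<Rightarrow> fm \<Rightarrow> bool"  (infix \<open>\<turnstile>\<close> 20) where
  Ax: "axiom A \<Longrightarrow> \<Gamma> \<turnstile> A"
| Assm: "A \<in> set \<Gamma> \<Longrightarrow> \<Gamma> \<turnstile> A"
| FalsumE: "\<Gamma> \<turnstile> \<^bold>\<bottom> \<Longrightarrow> \<Gamma> \<turnstile> A"
| AndI: "\<Gamma> \<turnstile> A \<Longrightarrow> \<Gamma> \<turnstile> B \<Longrightarrow> \<Gamma> \<turnstile> A \<^bold>\<and> B"
| AndE1: "\<Gamma> \<turnstile> A \<^bold>\<and> B \<Longrightarrow> \<Gamma> \<turnstile> A"
| AndE2: "\<Gamma> \<turnstile> A \<^bold>\<and> B \<Longrightarrow> \<Gamma> \<turnstile> B"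
| OrI1: "\<Gamma> \<turnstile> A \<Longrightarrow> \<Gamma> \<turnstile> A \<^bold>\<or> B"
| OrI2: "\<Gamma> \<turnstile> B \<Longrightarrow> \<Gamma> \<turnstile> A \<^bold>\<or> B"
| OrE: "\<Gamma> \<turnstile> A \<^bold>\<or> B \<Longrightarrow> A # \<Gamma> \<turnstile> C \<Longrightarrow> B # \<Gamma> \<turnstile> C \<Longrightarrow> \<Gamma> \<turnstile> C"
| ImpI: "A # \<Gamma> \<turnstile> B \<Longrightarrow> \<Gamma> \<turnstile> A \<^bold>\<longrightarrow> B"
| ImpE: "\<Gamma> \<turnstile> A \<^bold>\<longrightarrow> B \<Longrightarrow> \<Gamma> \<turnstile> A \<Longrightarrow> \<Gamma> \<turnstile> B"
| AllI: "map (ren_fm (weaken s)) \<Gamma> \<turnstile> A \<Longrightarrow> \<Gamma> \<turnstile> All s A"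
| AllE: "\<Gamma> \<turnstile> All (sort_of u) A \<Longrightarrow> \<Gamma> \<turnstile> inst u A"
| ExI: "\<Gamma> \<turnstile> inst u A \<Longrightarrow> \<Gamma> \<turnstile> Ex (sort_of u) A"
| ExE: "\<Gamma> \<turnstile> Ex s A \<Longrightarrow> A # map (ren_fm (weaken s)) \<Gamma> \<turnstile> ren_fm (weaken s) C \<Longrightarrow> \<Gamma> \<turnstile> C"

section \<open>Oriented reals\<close>

abbreviation q_up :: "sort \<Rightarrow> qterm \<Rightarrow> qterm" where
  "q_up s \<equiv> ren_q (weaken s)"

abbreviation qs_up :: "sort \<Rightarrow> qseq \<Rightarrow> qseq" where
  "qs_up s \<equiv> ren_qs (weaken s)"

text \<open>\<open>\<exists>\<close>-PEM: \<open>\<forall>a. (\<exists>n. a(n) = 0) \<or> \<not> (\<exists>n. a(n) = 0)\<close>\<close>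

definition ex_PEM :: fm where
  "ex_PEM =
    (let E = Ex Nat (NApp (NSVar 0) (NVar 0) =\<^sub>N Zero) in All NatSeq (E \<^bold>\<or> \<^bold>\<not> E))"

text \<open>\<open>\<exists>M. \<forall>n. \<alpha>(n) < \<alpha>(n + 1) \<and> \<alpha>(n + 1) < M\<close>\<close>

definition oriented_real :: "qseq \<Rightarrow> fm" where
  "oriented_real \<alpha> =
    (let \<alpha>' = qs_up Nat (qs_up Rat \<alpha>) in
     Ex Rat (All Nat (QApp \<alpha>' (NVar 0) <\<^sub>Q QApp \<alpha>' (Succ (NVar 0)) \<^bold>\<and>
                      QApp \<alpha>' (Succ (NVar 0)) <\<^sub>Q QVar 0)))"

text \<open>\<open>\<forall>m. \<exists>n. \<alpha>(m) < \<beta>(n)\<close>\<close>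

definition le :: "qseq \<Rightarrow> qseq \<Rightarrow> fm"  (infix \<open>\<le>\<^sub>o\<close> 50) where
  "\<alpha> \<le>\<^sub>o \<beta> =
    All Nat (Ex Nat (QApp (qs_up Nat (qs_up Nat \<alpha>)) (NVar 1) <\<^sub>Q
                     QApp (qs_up Nat (qs_up Nat \<beta>)) (NVar 0)))"

definition hat :: "qterm \<Rightarrow> qseq" where
  "hat x = QLam (QSub (q_up Nat x) (QInv (QOf (Succ (NVar 0)))))"

definition pow2 :: "nterm \<Rightarrow> qterm" where
  "pow2 t = QApp (QRec Q1 (QMul Q2 (QVar 0))) t"

text \<open>\<open>\<forall>n. \<exists>q. q \<le> \<alpha> \<and> \<alpha> \<le> q + 2\<^sup>-\<^sup>n\<close>\<close>

definition approximable :: "qseq \<Rightarrow> fm" where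
  "approximable \<alpha> =
    (let \<alpha>' = qs_up Rat (qs_up Nat \<alpha>) in
     All Nat (Ex Rat (hat (QVar 0) \<le>\<^sub>o \<alpha>' \<^bold>\<and>
                      \<alpha>' \<le>\<^sub>o hat (QAdd (QVar 0) (QInv (pow2 (NVar 0)))))))"

end

theory Submission
  imports Defs
begin

text \<open>
  Given a sequence \<open>a\<close>, let \<open>y\<close> start at \<open>5\<close> and drop to \<open>0\<close> for good after the first zero of \<open>a\<close>,
  and let \<open>\<alpha>(n) = - (y(n) + 2\<^sup>-\<^sup>n)\<close>. This is a strictly increasing sequence below \<open>0\<close>. Its terms lie
  below \<open>-5\<close> as long as no zero has been met and exceed \<open>-2\<close> afterwards. Let \<open>q \<le> \<alpha> \<le> q + 1\<close>. If
  \<open>q < -3\<close>, then every \<open>\<alpha>(n)\<close> is below \<open>-2\<close>, so \<open>a\<close> has no zero. Otherwise \<open>q > -4\<close>, hence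
  \<open>\<alpha>(n) > q - 1 > -5\<close> for some \<open>n\<close>, and \<open>a\<close> has a zero below \<open>n\<close>. As the order of the rationals is
  decidable, approximability of \<open>\<alpha>\<close> to within \<open>1\<close> decides whether \<open>a\<close> has a zero.
\<close>

section \<open>Substitution\<close>

definition comp_sub :: "substitution \<Rightarrow> renaming \<Rightarrow> substitution" where
  "comp_sub \<sigma> r = \<lparr>sub_NVar = \<lambda>i. sub_NVar \<sigma> (r Nat i), sub_QVar = \<lambda>i. sub_QVar \<sigma> (r Rat i),
     sub_NSVar = \<lambda>i. sub_NSVar \<sigma> (r NatSeq i), sub_QSVar = \<lambda>i. sub_QSVar \<sigma> (r RatSeq i)\<rparr>"

lemma comp_sub_up: "comp_sub (up_sub s \<sigma>) (up_ren s r) = up_sub s (comp_sub \<sigma> r)"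
  by (cases s) (auto simp: comp_sub_def up_sub_def up_ren_def weaken_sub_def fun_eq_iff split: nat.split)

lemma weaken_apply [simp]: "weaken s s' i = (if s' = s then Suc i else i)"
  by (simp add: weaken_def)

text \<open>Each binder lifts both maps, so the induction ranges over all \<open>\<sigma>\<close>
  and \<open>r\<close>; \<open>comp_sub_up\<close> says that lifting commutes with the
  composition.\<close>

lemma sub_ren_n:
  "sub_n \<sigma> (ren_n r t) = sub_n (comp_sub \<sigma> r) t"
  "sub_ns \<sigma> (ren_ns r f) = sub_ns (comp_sub \<sigma> r) f"
  by (induction t and f arbitrary: \<sigma> r and \<sigma> r) (simp_all add: comp_sub_up, simp_all add: comp_sub_def)

lemma sub_ren_q:
  "sub_q \<sigma> (ren_q r x) = sub_q (comp_sub \<sigma> r) x"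
  "sub_qs \<sigma> (ren_qs r g) = sub_qs (comp_sub \<sigma> r) g"
  by (induction x and g arbitrary: \<sigma> r and \<sigma> r)
    (simp_all add: comp_sub_up sub_ren_n, simp_all add: comp_sub_def)

lemma up_sub_id [simp]: "up_sub s id_sub = id_sub"
  by (cases s) (auto simp: up_sub_def weaken_sub_def weaken_def id_sub_def fun_eq_iff split: nat.split)

lemma id_sub_sel [simp]:
  "sub_NVar id_sub = NVar" "sub_QVar id_sub = QVar"
  "sub_NSVar id_sub = NSVar" "sub_QSVar id_sub = QSVar"
  by (simp_all add: id_sub_def)

lemma sub_n_id [simp]: "sub_n id_sub t = t" "sub_ns id_sub f = f"
  by (induction t and f) simp_all

lemma sub_q_id [simp]: "sub_q id_sub x = x" "sub_qs id_sub g = g"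
  by (induction x and g) simp_all

text \<open>Weakening skips exactly the index that \<open>bind\<close> fills. For
  \<open>id_sub\<close> this means that instantiating a weakened term gives the term back.\<close>

lemma comp_sub_bind_weaken [simp]: "comp_sub (bind u \<sigma>) (weaken (sort_of u)) = \<sigma>"
  by (cases u) (simp_all add: comp_sub_def weaken_def)

text \<open>The same fact in the form reached once the simplifier has unfolded
  \<open>bind\<close>.\<close>

lemma comp_sub_bind_id [simp]:
  "comp_sub (id_sub\<lparr>sub_NVar := case_nat t NVar\<rparr>) (weaken Nat) = id_sub"
  "comp_sub (id_sub\<lparr>sub_QVar := case_nat x QVar\<rparr>) (weaken Rat) = id_sub"
  using comp_sub_bind_weaken[of "NObj t" id_sub] comp_sub_bind_weaken[of "QObj x" id_sub]
  by simp_all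

section \<open>Derived rules\<close>

lemma weakening: "\<Gamma> \<turnstile> A \<Longrightarrow> set \<Gamma> \<subseteq> set \<Delta> \<Longrightarrow> \<Delta> \<turnstile> A"
proof (induction arbitrary: \<Delta> rule: derivable.induct)
  case (OrE \<Gamma> A B C)
  show ?case
    by (rule derivable.OrE[OF OrE.IH(1)[OF OrE.prems]]; rule OrE.IH) (use OrE.prems in auto)
next
  case (ImpI A \<Gamma> B)
  show ?case by (rule derivable.ImpI, rule ImpI.IH) (use ImpI.prems in auto)
next
  case (AllI s \<Gamma> A)
  show ?case by (rule derivable.AllI, rule AllI.IH) (use AllI.prems in auto)
next
  case (ExE \<Gamma> s A C)
  show ?case
    by (rule derivable.ExE[OF ExE.IH(1)[OF ExE.prems]]; rule ExE.IH) (use ExE.prems in auto)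
qed (auto intro: derivable.intros)

lemma derivable_from_empty: "[] \<turnstile> A \<Longrightarrow> \<Gamma> \<turnstile> A"
  by (erule weakening) simp

lemma cut: "\<Gamma> \<turnstile> A \<Longrightarrow> A # \<Gamma> \<turnstile> B \<Longrightarrow> \<Gamma> \<turnstile> B"
  by (rule ImpE[OF ImpI])

lemma All_Nat_inst: "\<Gamma> \<turnstile> All Nat A \<Longrightarrow> \<Gamma> \<turnstile> inst (NObj t) A"
  using AllE[of \<Gamma> "NObj t" A] by simp

lemma Ex_Nat_witness: "\<Gamma> \<turnstile> inst (NObj t) A \<Longrightarrow> \<Gamma> \<turnstile> Ex Nat A"
  using ExI[of \<Gamma> "NObj t" A] by simp

text \<open>Both premises are free of side assumptions, so \<open>AllI\<close> has no context to
  rename; weakening then carries the result to any context.\<close>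

lemma induct_Nat:
  assumes "[] \<turnstile> inst (NObj Zero) A" and "[A] \<turnstile> inst_Succ A"
  shows "\<Gamma> \<turnstile> inst (NObj t) A"
proof -
  have "[] \<turnstile> All Nat (A \<^bold>\<longrightarrow> inst_Succ A)"
    using assms(2) by (simp add: AllI ImpI)
  then have "[] \<turnstile> All Nat A"
    using Ax[OF axiom.induction] assms(1) ImpE by blast
  then show ?thesis
    by (blast intro: derivable_from_empty All_Nat_inst)
qed

section \<open>Equality as a congruence\<close>

lemma NEq_replace: "\<Gamma> \<turnstile> s =\<^sub>N t \<Longrightarrow> \<Gamma> \<turnstile> inst (NObj s) A \<Longrightarrow> \<Gamma> \<turnstile> inst (NObj t) A"
  by (meson Ax ImpE axiom.NEq_subst)

lemma QEq_replace: "\<Gamma> \<turnstile> x =\<^sub>Q y \<Longrightarrow> \<Gamma> \<turnstile> inst (QObj x) A \<Longrightarrow> \<Gamma> \<turnstile> inst (QObj y) A"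
  by (meson Ax ImpE axiom.QEq_subst)

lemma QEq_refl: "\<Gamma> \<turnstile> x =\<^sub>Q x"
  by (simp add: Ax axiom.QEq_refl)

text \<open>Leibniz's rule is applied to a template: \<open>QVar 0\<close> marks the place to be
  replaced, and the other terms are weakened so that instantiation leaves them alone. Most
  congruence rules below use such templates.\<close>

lemma QEq_sym: "\<Gamma> \<turnstile> x =\<^sub>Q y \<Longrightarrow> \<Gamma> \<turnstile> y =\<^sub>Q x"
  using QEq_replace[of \<Gamma> x y "QVar 0 =\<^sub>Q q_up Rat x"]
  by (simp add: inst_def sub_ren_q QEq_refl)

lemma QEq_trans: "\<Gamma> \<turnstile> x =\<^sub>Q y \<Longrightarrow> \<Gamma> \<turnstile> y =\<^sub>Q z \<Longrightarrow> \<Gamma> \<turnstile> x =\<^sub>Q z"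
  using QEq_replace[of \<Gamma> y z "q_up Rat x =\<^sub>Q QVar 0"]
  by (simp add: inst_def sub_ren_q)

lemma QNeg_cong: "\<Gamma> \<turnstile> x =\<^sub>Q y \<Longrightarrow> \<Gamma> \<turnstile> QNeg x =\<^sub>Q QNeg y"
  using QEq_replace[of \<Gamma> x y "QNeg (q_up Rat x) =\<^sub>Q QNeg (QVar 0)"]
  by (simp add: inst_def sub_ren_q QEq_refl)

lemma QInv_cong: "\<Gamma> \<turnstile> x =\<^sub>Q y \<Longrightarrow> \<Gamma> \<turnstile> QInv x =\<^sub>Q QInv y"
  using QEq_replace[of \<Gamma> x y "QInv (q_up Rat x) =\<^sub>Q QInv (QVar 0)"]
  by (simp add: inst_def sub_ren_q QEq_refl)

lemma QAdd_cong_left: "\<Gamma> \<turnstile> x =\<^sub>Q y \<Longrightarrow> \<Gamma> \<turnstile> QAdd x z =\<^sub>Q QAdd y z"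
  using QEq_replace[of \<Gamma> x y "QAdd (q_up Rat x) (q_up Rat z) =\<^sub>Q QAdd (QVar 0) (q_up Rat z)"]
  by (simp add: inst_def sub_ren_q QEq_refl)

lemma QMul_cong_left: "\<Gamma> \<turnstile> x =\<^sub>Q y \<Longrightarrow> \<Gamma> \<turnstile> QMul x z =\<^sub>Q QMul y z"
  using QEq_replace[of \<Gamma> x y "QMul (q_up Rat x) (q_up Rat z) =\<^sub>Q QMul (QVar 0) (q_up Rat z)"]
  by (simp add: inst_def sub_ren_q QEq_refl)

lemma QAdd_cong:
  assumes "\<Gamma> \<turnstile> x =\<^sub>Q x'" "\<Gamma> \<turnstile> y =\<^sub>Q y'"
  shows "\<Gamma> \<turnstile> QAdd x y =\<^sub>Q QAdd x' y'"
  by (meson Ax QAdd_cong_left QEq_trans assms axiom.QAdd_commute)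

lemma QMul_cong:
  assumes "\<Gamma> \<turnstile> x =\<^sub>Q x'" "\<Gamma> \<turnstile> y =\<^sub>Q y'"
  shows "\<Gamma> \<turnstile> QMul x y =\<^sub>Q QMul x' y'"
  by (meson Ax QMul_cong_left QEq_trans assms axiom.QMul_commute)

lemma QLess_cong:
  assumes "\<Gamma> \<turnstile> x =\<^sub>Q x'" "\<Gamma> \<turnstile> y =\<^sub>Q y'" "\<Gamma> \<turnstile> x <\<^sub>Q y"
  shows "\<Gamma> \<turnstile> x' <\<^sub>Q y'"
  using QEq_replace[OF assms(1), of "QVar 0 <\<^sub>Q q_up Rat y"]
    QEq_replace[OF assms(2), of "q_up Rat x' <\<^sub>Q QVar 0"] assms(3)
  by (simp add: inst_def sub_ren_q)

lemma QApp_cong: "\<Gamma> \<turnstile> s =\<^sub>N t \<Longrightarrow> \<Gamma> \<turnstile> QApp g s =\<^sub>Q QApp g t"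
  using NEq_replace[of \<Gamma> s t "QApp (qs_up Nat g) (ren_n (weaken Nat) s) =\<^sub>Q QApp (qs_up Nat g) (NVar 0)"]
  by (simp add: inst_def sub_ren_q sub_ren_n QEq_refl)

section \<open>The ring of rational terms\<close>

text \<open>Terms modulo equality provable without assumptions form a commutative ring, so that identities
  between rational terms can be derived by the simplifier. The class \<open>comm_ring_1\<close> is avoided,
  since its axiom \<open>0 \<noteq> 1\<close> amounts to the consistency of the base theory.\<close>

quotient_type qring = qterm / "\<lambda>x y. [] \<turnstile> x =\<^sub>Q y"
  by (rule equivpI) (auto intro!: reflpI sympI transpI intro: QEq_refl QEq_sym QEq_trans)

instantiation qring :: "{comm_ring, comm_monoid_mult}"
begin

lift_definition zero_qring :: qring is Q0 .
lift_definition one_qring :: qring is Q1 .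
lift_definition plus_qring :: "qring \<Rightarrow> qring \<Rightarrow> qring" is QAdd by (rule QAdd_cong)
lift_definition times_qring :: "qring \<Rightarrow> qring \<Rightarrow> qring" is QMul by (rule QMul_cong)
lift_definition uminus_qring :: "qring \<Rightarrow> qring" is QNeg by (rule QNeg_cong)
lift_definition minus_qring :: "qring \<Rightarrow> qring \<Rightarrow> qring" is QSub by (intro QAdd_cong QNeg_cong)

instance
proof
  fix a b c :: qring
  show "a + b + c = a + (b + c)" by transfer (rule Ax[OF axiom.QAdd_assoc])
  show "a + b = b + a" by transfer (rule Ax[OF axiom.QAdd_commute])
  show "0 + a = a"
    by transfer (rule QEq_trans[OF Ax[OF axiom.QAdd_commute] Ax[OF axiom.QAdd_Q0]])
  show "- a + a = 0"
    by transfer (rule QEq_trans[OF Ax[OF axiom.QAdd_commute] Ax[OF axiom.QAdd_QNeg]])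
  show "a - b = a + - b" by transfer (rule QEq_refl)
  show "a * b * c = a * (b * c)" by transfer (rule Ax[OF axiom.QMul_assoc])
  show "a * b = b * a" by transfer (rule Ax[OF axiom.QMul_commute])
  show "1 * a = a"
    by transfer (rule QEq_trans[OF Ax[OF axiom.QMul_commute] Ax[OF axiom.QMul_Q1]])
  show "(a + b) * c = a * c + b * c"
    by transfer (meson Ax QAdd_cong QEq_trans axiom.QMul_QAdd axiom.QMul_commute)
qed

end

abbreviation ev :: "qterm \<Rightarrow> qring" where
  "ev \<equiv> abs_qring"

lift_definition qinv :: "qring \<Rightarrow> qring" is QInv by (rule QInv_cong)

lemma ev_eq_iff: "ev x = ev y \<longleftrightarrow> ([] \<turnstile> x =\<^sub>Q y)"
  by (rule qring.abs_eq_iff)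

text \<open>Iterating the last equation turns numerals such as \<open>Q2\<close> into sums of ones
  in the ring.\<close>

lemma ev_simps [simp]:
  "ev (QAdd x y) = ev x + ev y" "ev (QMul x y) = ev x * ev y" "ev (QNeg x) = - ev x"
  "ev (QInv x) = qinv (ev x)" "ev Q0 = 0" "ev (QOf (Succ t)) = ev (QOf t) + 1"
  by (simp_all add: plus_qring.abs_eq times_qring.abs_eq uminus_qring.abs_eq qinv.abs_eq
      zero_qring.abs_eq one_qring.abs_eq) (simp add: ev_eq_iff Ax axiom.QOf_Succ)

text \<open>Positivity and vanishing under assumptions are predicates on the ring. An inequality is then
  derived by writing a difference as a sum of positive and vanishing elements.\<close>

definition Pos :: "fm list \<Rightarrow> qring \<Rightarrow> bool" where
  "Pos \<Gamma> r \<longleftrightarrow> (\<exists>x. r = ev x \<and> (\<Gamma> \<turnstile> Q0 <\<^sub>Q x))"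

definition Zer :: "fm list \<Rightarrow> qring \<Rightarrow> bool" where
  "Zer \<Gamma> r \<longleftrightarrow> (\<exists>x. r = ev x \<and> (\<Gamma> \<turnstile> x =\<^sub>Q Q0))"

lemma QEq_ev: "ev x = ev y \<Longrightarrow> \<Gamma> \<turnstile> x =\<^sub>Q y"
  by (simp add: ev_eq_iff derivable_from_empty)

lemma QLess_ev: "\<Gamma> \<turnstile> x <\<^sub>Q y \<Longrightarrow> ev x = ev x' \<Longrightarrow> ev y = ev y' \<Longrightarrow> \<Gamma> \<turnstile> x' <\<^sub>Q y'"
  by (meson QEq_ev QLess_cong)

lemma QAdd_strict_mono: "\<Gamma> \<turnstile> x <\<^sub>Q y \<Longrightarrow> \<Gamma> \<turnstile> QAdd x z <\<^sub>Q QAdd y z"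
  by (meson Ax ImpE axiom.QAdd_mono)

lemma QLess_trans: "\<Gamma> \<turnstile> x <\<^sub>Q y \<Longrightarrow> \<Gamma> \<turnstile> y <\<^sub>Q z \<Longrightarrow> \<Gamma> \<turnstile> x <\<^sub>Q z"
  by (meson Ax ImpE axiom.QLess_trans)

text \<open>Adding \<open>QNeg x\<close> to both sides gives one direction, adding \<open>x\<close>
  the other. From here on inequalities are handled by ring identities.\<close>

lemma QLess_iff_Pos: "(\<Gamma> \<turnstile> x <\<^sub>Q y) \<longleftrightarrow> Pos \<Gamma> (ev y - ev x)"
proof
  assume "\<Gamma> \<turnstile> x <\<^sub>Q y"
  then have "\<Gamma> \<turnstile> Q0 <\<^sub>Q QSub y x"
    by (rule QLess_ev[OF QAdd_strict_mono[where z = "QNeg x"]]) simp_all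
  then show "Pos \<Gamma> (ev y - ev x)"
    unfolding Pos_def by (intro exI[of _ "QSub y x"]) simp
next
  assume "Pos \<Gamma> (ev y - ev x)"
  then obtain z where z: "ev y - ev x = ev z" "\<Gamma> \<turnstile> Q0 <\<^sub>Q z"
    unfolding Pos_def by blast
  from z(1) have "ev z + ev x = ev y"
    by (metis diff_add_cancel)
  then show "\<Gamma> \<turnstile> x <\<^sub>Q y"
    by (intro QLess_ev[OF QAdd_strict_mono[OF z(2), where z = x]]) simp_all
qed

lemma QEq_iff_Zer: "(\<Gamma> \<turnstile> x =\<^sub>Q y) \<longleftrightarrow> Zer \<Gamma> (ev x - ev y)"
proof
  assume "\<Gamma> \<turnstile> x =\<^sub>Q y"
  then have "\<Gamma> \<turnstile> QSub x y =\<^sub>Q QSub y y"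
    by (rule QAdd_cong_left)
  then have "\<Gamma> \<turnstile> QSub x y =\<^sub>Q Q0"
    by (rule QEq_trans) (simp add: QEq_ev)
  then show "Zer \<Gamma> (ev x - ev y)"
    unfolding Zer_def by (intro exI[of _ "QSub x y"]) simp
next
  assume "Zer \<Gamma> (ev x - ev y)"
  then obtain z where z: "ev x - ev y = ev z" "\<Gamma> \<turnstile> z =\<^sub>Q Q0"
    unfolding Zer_def by blast
  have "\<Gamma> \<turnstile> x =\<^sub>Q QAdd z y"
    by (rule QEq_ev) (simp flip: z(1))
  then show "\<Gamma> \<turnstile> x =\<^sub>Q y"
    by (rule QEq_trans[OF _ QEq_trans[OF QAdd_cong_left[OF z(2)]]]) (simp add: QEq_ev)
qed


section \<open>Closure rules for positive and vanishing elements\<close>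

lemma Pos_add: "Pos \<Gamma> r \<Longrightarrow> Pos \<Gamma> s \<Longrightarrow> Pos \<Gamma> (r + s)"
proof -
  assume "Pos \<Gamma> r" "Pos \<Gamma> s"
  then obtain x y where x: "r = ev x" "\<Gamma> \<turnstile> Q0 <\<^sub>Q x" and y: "s = ev y" "\<Gamma> \<turnstile> Q0 <\<^sub>Q y"
    unfolding Pos_def by blast
  have "\<Gamma> \<turnstile> x <\<^sub>Q QAdd x y"
    by (rule QLess_ev[OF QAdd_strict_mono[OF y(2), where z = x]]) simp_all
  then have "\<Gamma> \<turnstile> Q0 <\<^sub>Q QAdd x y"
    by (rule QLess_trans[OF x(2)])
  then show ?thesis
    unfolding Pos_def by (intro exI[of _ "QAdd x y"]) (simp add: x y)
qed

lemma Pos_mult: "Pos \<Gamma> r \<Longrightarrow> Pos \<Gamma> s \<Longrightarrow> Pos \<Gamma> (r * s)"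
proof -
  assume "Pos \<Gamma> r" "Pos \<Gamma> s"
  then obtain x y where x: "r = ev x" "\<Gamma> \<turnstile> Q0 <\<^sub>Q x" and y: "s = ev y" "\<Gamma> \<turnstile> Q0 <\<^sub>Q y"
    unfolding Pos_def by blast
  have "\<Gamma> \<turnstile> Q0 <\<^sub>Q QMul x y"
    by (rule ImpE[OF ImpE[OF Ax[OF axiom.QMul_pos] x(2)] y(2)])
  then show ?thesis
    unfolding Pos_def by (intro exI[of _ "QMul x y"]) (simp add: x y)
qed

lemma Zer_add: "Zer \<Gamma> r \<Longrightarrow> Zer \<Gamma> s \<Longrightarrow> Zer \<Gamma> (r + s)"
proof -
  assume "Zer \<Gamma> r" "Zer \<Gamma> s"
  then obtain x y where x: "r = ev x" "\<Gamma> \<turnstile> x =\<^sub>Q Q0" and y: "s = ev y" "\<Gamma> \<turnstile> y =\<^sub>Q Q0"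
    unfolding Zer_def by blast
  have "\<Gamma> \<turnstile> QAdd x y =\<^sub>Q Q0"
    by (rule QEq_trans[OF QAdd_cong[OF x(2) y(2)]]) (simp add: QEq_ev)
  then show ?thesis
    unfolding Zer_def by (intro exI[of _ "QAdd x y"]) (simp add: x y)
qed

lemma Zer_mult: "Zer \<Gamma> r \<Longrightarrow> Zer \<Gamma> (r * s)"
proof -
  assume "Zer \<Gamma> r"
  then obtain x where x: "r = ev x" "\<Gamma> \<turnstile> x =\<^sub>Q Q0"
    unfolding Zer_def by blast
  \<comment> \<open>The quotient map is surjective.\<close>
  obtain y where y: "s = ev y"
    by (metis Quotient3_abs_rep Quotient3_qring)
  have "\<Gamma> \<turnstile> QMul x y =\<^sub>Q Q0"
    by (rule QEq_trans[OF QMul_cong_left[OF x(2)]]) (simp add: QEq_ev)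
  then show ?thesis
    unfolding Zer_def by (intro exI[of _ "QMul x y"]) (simp add: x y)
qed

lemma Pos_add_Zer: "Pos \<Gamma> r \<Longrightarrow> Zer \<Gamma> s \<Longrightarrow> Pos \<Gamma> (r + s)"
proof -
  assume "Pos \<Gamma> r" "Zer \<Gamma> s"
  then obtain x y where x: "r = ev x" "\<Gamma> \<turnstile> Q0 <\<^sub>Q x" and y: "s = ev y" "\<Gamma> \<turnstile> y =\<^sub>Q Q0"
    unfolding Pos_def Zer_def by blast
  have "\<Gamma> \<turnstile> x =\<^sub>Q QAdd x y"
    by (rule QEq_trans[OF _ QAdd_cong[OF QEq_refl QEq_sym[OF y(2)]]]) (simp add: QEq_ev)
  then have "\<Gamma> \<turnstile> Q0 <\<^sub>Q QAdd x y"
    by (rule QLess_cong[OF QEq_refl _ x(2)])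
  then show ?thesis
    unfolding Pos_def by (intro exI[of _ "QAdd x y"]) (simp add: x y)
qed

lemma Pos_1: "Pos \<Gamma> 1"
  using QLess_iff_Pos[of \<Gamma> Q0 Q1] by (simp add: Ax axiom.Q0_less_Q1)

text \<open>The way contradictions are reached below: positive and vanishing elements are added up
  until everything cancels.\<close>

lemma Pos_0: "Pos \<Gamma> 0 \<Longrightarrow> \<Gamma> \<turnstile> A"
  using QLess_iff_Pos[of \<Gamma> Q0 Q0]
  by (simp add: FalsumE[OF ImpE[OF Ax[OF axiom.QLess_irrefl]]])

lemma Pos_mono: "Pos \<Gamma> r \<Longrightarrow> set \<Gamma> \<subseteq> set \<Delta> \<Longrightarrow> Pos \<Delta> r"
  unfolding Pos_def by (blast intro: weakening)

text \<open>This case distinction is intuitionistically sound because the order of the rationals is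
  decidable by axiom.\<close>

lemma trichotomy:
  assumes "(x <\<^sub>Q y) # \<Gamma> \<turnstile> C" and "(x =\<^sub>Q y) # \<Gamma> \<turnstile> C" and "(y <\<^sub>Q x) # \<Gamma> \<turnstile> C"
  shows "\<Gamma> \<turnstile> C"
proof (rule OrE[OF Ax[OF axiom.QLess_linear[of x y]] assms(1)])
  show "(x =\<^sub>Q y \<^bold>\<or> y <\<^sub>Q x) # \<Gamma> \<turnstile> C"
    by (rule OrE[OF Assm, of "x =\<^sub>Q y" "y <\<^sub>Q x"])
      (auto intro: weakening[OF assms(2)] weakening[OF assms(3)])
qed

lemma QLess_Assm: "(x <\<^sub>Q y) \<in> set \<Gamma> \<Longrightarrow> Pos \<Gamma> (ev y - ev x)"
  by (simp add: Assm flip: QLess_iff_Pos)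

lemma QEq_Assm: "(x =\<^sub>Q y) \<in> set \<Gamma> \<Longrightarrow> Zer \<Gamma> (ev x - ev y)"
  by (simp add: Assm flip: QEq_iff_Zer)

text \<open>An equation in the ring means provability without assumptions, hence the empty context
  in the premise. A positive \<open>x\<close> is nonzero, which is what the axiom on
  \<open>QInv\<close> asks for.\<close>

lemma mult_qinv: "Pos [] r \<Longrightarrow> r * qinv r = 1"
proof -
  assume "Pos [] r"
  then obtain x where x: "r = ev x" "[] \<turnstile> Q0 <\<^sub>Q x"
    unfolding Pos_def by blast
  have "[x =\<^sub>Q Q0] \<turnstile> \<^bold>\<bottom>"
  proof -
    let ?G = "[x =\<^sub>Q Q0]"
    have "Pos ?G (r + r * - 1)"
      using QEq_Assm[of x Q0 ?G] \<open>Pos [] r\<close>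
      by (intro Pos_add_Zer Zer_mult) (simp_all add: Pos_mono[of "[]"] x(1))
    then show ?thesis
      by (intro Pos_0) (simp add: minus_mult_right[symmetric])
  qed
  then have "[] \<turnstile> QMul x (QInv x) =\<^sub>Q Q1"
    by (intro ImpE[OF Ax[OF axiom.QMul_QInv]] ImpI)
  then have "ev (QMul x (QInv x)) = ev Q1"
    by (simp only: ev_eq_iff)
  then show ?thesis
    by (simp add: x)
qed

text \<open>If \<open>s\<close> were negative or zero, then \<open>r * s\<close> plus its negative
  would be a positive element equal to 0.\<close>

lemma Pos_factor:
  assumes "Pos \<Gamma> (r * s)" and "Pos \<Gamma> r"
  shows "Pos \<Gamma> s"
proof -
  obtain x where x: "s = ev x"
    by (metis Quotient3_abs_rep Quotient3_qring)
  let ?G = "\<lambda>A. A # \<Gamma>"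
  have "\<Gamma> \<turnstile> Q0 <\<^sub>Q x"
  proof (rule trichotomy[of x Q0])
    have "Pos (?G (x <\<^sub>Q Q0)) (r * (- s))"
      using QLess_Assm[of x Q0 "?G (x <\<^sub>Q Q0)"]
      by (intro Pos_mult Pos_mono[OF assms(2)]) (auto simp: x)
    then have "Pos (?G (x <\<^sub>Q Q0)) (r * s + r * (- s))"
      by (intro Pos_add Pos_mono[OF assms(1)]) auto
    then show "?G (x <\<^sub>Q Q0) \<turnstile> Q0 <\<^sub>Q x"
      by (intro Pos_0) simp
  next
    have "Zer (?G (x =\<^sub>Q Q0)) (s * (- r))"
      using QEq_Assm[of x Q0 "?G (x =\<^sub>Q Q0)"] by (intro Zer_mult) (auto simp: x)
    then have "Pos (?G (x =\<^sub>Q Q0)) (r * s + s * (- r))"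
      by (intro Pos_add_Zer Pos_mono[OF assms(1)]) auto
    then show "?G (x =\<^sub>Q Q0) \<turnstile> Q0 <\<^sub>Q x"
      by (intro Pos_0) (simp add: mult.commute)
  qed (simp add: Assm)
  then show ?thesis
    by (simp add: QLess_iff_Pos x)
qed

lemma qinv_1 [simp]: "qinv 1 = 1"
  using mult_qinv[OF Pos_1] by simp

lemma Pos_qinv: "Pos [] r \<Longrightarrow> Pos \<Gamma> (qinv r)"
  by (rule Pos_factor[of \<Gamma> r]) (simp_all add: mult_qinv Pos_1 Pos_mono[of "[]"])

text \<open>With \<open>Pos_qinv\<close> this makes the fraction 1/(n+1) in \<open>hat\<close>
  positive.\<close>

lemma Pos_QOf_Succ: "Pos \<Gamma> (ev (QOf t) + 1)"
proof -
  let ?A = "Q0 <\<^sub>Q QOf (Succ (NVar 0))"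
  have "\<Gamma> \<turnstile> inst (NObj t) ?A"
  proof (rule induct_Nat)
    show "[] \<turnstile> inst (NObj Zero) ?A"
      by (simp add: inst_def QLess_iff_Pos Pos_1)
    have "Pos [?A] (ev (QOf (NVar 0)) + 1 + 1)"
      using QLess_Assm[of Q0 "QOf (Succ (NVar 0))" "[?A]"] by - (rule Pos_add[OF _ Pos_1], simp)
    then show "[?A] \<turnstile> inst_Succ ?A"
      by (simp add: inst_Succ_def QLess_iff_Pos)
  qed
  then show ?thesis
    by (simp add: inst_def QLess_iff_Pos)
qed

section \<open>The oriented real attached to a sequence of naturals\<close>

text \<open>The free variable \<open>NSVar 0\<close> is the given sequence \<open>a\<close>; the
  formula is the first disjunct in \<open>ex_PEM\<close>.\<close>

definition zero_exists :: fm where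
  "zero_exists = Ex Nat (NApp (NSVar 0) (NVar 0) =\<^sub>N Zero)"

abbreviation Q3 :: qterm where "Q3 \<equiv> QOf (Succ (Succ (Succ Zero)))"
abbreviation Q4 :: qterm where "Q4 \<equiv> QOf (Succ (Succ (Succ (Succ Zero))))"
abbreviation Q5 :: qterm where "Q5 \<equiv> QOf (Succ (Succ (Succ (Succ (Succ Zero)))))"

text \<open>The signum function on the naturals, with rational values: recursion with a constant
  step acts as a case distinction.\<close>

definition sgn_seq :: qseq where
  "sgn_seq = QRec Q0 Q1"

text \<open>The sequence \<open>y\<close> of the overview. Its value at n+1 is y(n) times the signum
  of a(n), so a zero of \<open>a\<close> at n shows up at n+1 and persists.\<close>

definition jump :: qseq where
  "jump = QRec Q5 (QMul (QVar 0) (QApp sgn_seq (NApp (NSVar 0) (NVar 0))))"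

text \<open>The powers 1/2^n, which keep \<open>alpha\<close> strictly increasing while
  \<open>jump\<close> is constant.\<close>

definition halves :: qseq where
  "halves = QRec Q1 (QMul (QVar 0) (QInv Q2))"

definition alpha :: qseq where
  "alpha = QLam (QNeg (QAdd (QApp jump (NVar 0)) (QApp halves (NVar 0))))"

text \<open>At most \<open>NSVar 0\<close> occurs free in these expressions, so they survive every
  quantifier step that keeps this variable fixed.\<close>

lemma sub_seqs [simp]:
  "sub_qs \<sigma> sgn_seq = sgn_seq"
  "sub_qs \<sigma> halves = halves"
  "sub_NSVar \<sigma> 0 = NSVar 0 \<Longrightarrow> sub_qs \<sigma> jump = jump"
  "sub_NSVar \<sigma> 0 = NSVar 0 \<Longrightarrow> sub_qs \<sigma> alpha = alpha"
  "sub_NSVar \<sigma> 0 = NSVar 0 \<Longrightarrow> sub_fm \<sigma> zero_exists = zero_exists"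
  by (simp_all add: sgn_seq_def halves_def jump_def alpha_def zero_exists_def
      up_sub_def weaken_sub_def weaken_def)

lemma ren_seqs [simp]:
  "ren_qs r sgn_seq = sgn_seq"
  "ren_qs r halves = halves"
  "r NatSeq 0 = 0 \<Longrightarrow> ren_qs r jump = jump"
  "r NatSeq 0 = 0 \<Longrightarrow> ren_qs r alpha = alpha"
  "r NatSeq 0 = 0 \<Longrightarrow> ren_fm r zero_exists = zero_exists"
  by (simp_all add: sgn_seq_def halves_def jump_def alpha_def zero_exists_def up_ren_def)

section \<open>Evaluation of the sequences\<close>

lemma ev_QLam: "ev (QApp (QLam x) t) = ev (sub_q (bind (NObj t) id_sub) x)"
  unfolding ev_eq_iff by (rule Ax[OF axiom.QLam])

lemma ev_QRec_Zero: "ev (QApp (QRec x y) Zero) = ev x"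
  by (simp add: ev_eq_iff Ax axiom.QRec_Zero)

lemma ev_QRec_Succ: "ev (QApp (QRec x y) (Succ t)) =
    ev (sub_q (bind (QObj (QApp (QRec x y) t)) (bind (NObj t) id_sub)) y)"
  unfolding ev_eq_iff by (rule Ax[OF axiom.QRec_Succ])

lemma ev_sgn_seq:
  "ev (QApp sgn_seq Zero) = 0" "ev (QApp sgn_seq (Succ t)) = 1"
  by (simp_all add: sgn_seq_def ev_QRec_Zero ev_QRec_Succ)

lemma ev_jump:
  "ev (QApp jump Zero) = ev Q5"
  "ev (QApp jump (Succ t)) = ev (QApp jump t) * ev (QApp sgn_seq (NApp (NSVar 0) t))"
  using ev_QRec_Zero ev_QRec_Succ[where x = Q5] sub_seqs(1) by (simp_all add: jump_def)

lemma ev_halves: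
  "ev (QApp halves Zero) = 1"
  "ev (QApp halves (Succ t)) = ev (QApp halves t) * qinv (1 + 1)"
  by (simp_all add: halves_def ev_QRec_Zero ev_QRec_Succ)

lemma ev_alpha: "ev (QApp alpha t) = - (ev (QApp jump t) + ev (QApp halves t))"
  by (simp add: alpha_def ev_QLam)

text \<open>Induction serves as the distinction between zero and successor. The left disjunct
  retains \<open>t =\<^sub>N Zero\<close>, from which \<open>zero_exists\<close> is obtained when
  \<open>t\<close> is a value of \<open>a\<close>.\<close>

lemma sgn_seq_cases:
  "\<Gamma> \<turnstile> (t =\<^sub>N Zero \<^bold>\<and> QApp sgn_seq t =\<^sub>Q Q0) \<^bold>\<or> QApp sgn_seq t =\<^sub>Q Q1"
proof -
  let ?A = "(NVar 0 =\<^sub>N Zero \<^bold>\<and> QApp sgn_seq (NVar 0) =\<^sub>Q Q0) \<^bold>\<or> QApp sgn_seq (NVar 0) =\<^sub>Q Q1"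
  have "\<Gamma> \<turnstile> inst (NObj t) ?A"
  proof (rule induct_Nat)
    show "[] \<turnstile> inst (NObj Zero) ?A"
      by (simp add: inst_def ev_sgn_seq OrI1 AndI QEq_ev Ax axiom.NEq_refl)
    show "[?A] \<turnstile> inst_Succ ?A"
      by (auto simp: inst_Succ_def ev_sgn_seq intro!: OrI2 QEq_ev)
  qed
  then show ?thesis
    by (simp add: inst_def)
qed

text \<open>The constructive core: a dropped value carries evidence for a zero of \<open>a\<close>.
  In the induction step the value 0 persists, and at the value 5 the signum of a(n) decides whether
  the drop happens.\<close>

lemma jump_cases:
  "\<Gamma> \<turnstile> (QApp jump t =\<^sub>Q Q0 \<^bold>\<and> zero_exists) \<^bold>\<or> QApp jump t =\<^sub>Q Q5"
proof -
  let ?n = "NVar 0"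
  let ?y = "QApp jump ?n" and ?y' = "QApp jump (Succ ?n)" and ?w = "QApp sgn_seq (NApp (NSVar 0) ?n)"
  let ?A = "(?y =\<^sub>Q Q0 \<^bold>\<and> zero_exists) \<^bold>\<or> ?y =\<^sub>Q Q5"
  let ?B = "(?y' =\<^sub>Q Q0 \<^bold>\<and> zero_exists) \<^bold>\<or> ?y' =\<^sub>Q Q5"
  have "\<Gamma> \<turnstile> inst (NObj t) ?A"
  proof (rule induct_Nat)
    show "[] \<turnstile> inst (NObj Zero) ?A"
      by (auto simp: inst_def ev_jump intro!: OrI2 QEq_ev)
    have "[?A] \<turnstile> ?B"
    proof (rule OrE[OF Assm])
      let ?G = "[?y =\<^sub>Q Q0 \<^bold>\<and> zero_exists, ?A]"
      have 1: "?G \<turnstile> ?y =\<^sub>Q Q0" and 2: "?G \<turnstile> zero_exists"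
        by (rule AndE1[OF Assm] AndE2[OF Assm], simp)+
      from 1 have "?G \<turnstile> ?y' =\<^sub>Q Q0"
        using Zer_mult[of ?G "ev ?y" "ev ?w"] by (simp add: QEq_iff_Zer ev_jump)
      with 2 show "?G \<turnstile> ?B"
        by (intro OrI1 AndI)
    next
      let ?G = "[?y =\<^sub>Q Q5, ?A]"
      show "?G \<turnstile> ?B"
      proof (rule OrE[OF sgn_seq_cases[of _ "NApp (NSVar 0) ?n"]])
        let ?G' = "(NApp (NSVar 0) ?n =\<^sub>N Zero \<^bold>\<and> ?w =\<^sub>Q Q0) # ?G"
        have 1: "?G' \<turnstile> NApp (NSVar 0) ?n =\<^sub>N Zero" and 2: "?G' \<turnstile> ?w =\<^sub>Q Q0"
          by (rule AndE1[OF Assm] AndE2[OF Assm], simp)+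
        from 2 have "?G' \<turnstile> ?y' =\<^sub>Q Q0"
          using Zer_mult[of ?G' "ev ?w" "ev ?y"] by (simp add: QEq_iff_Zer ev_jump mult.commute)
        moreover from 1 have "?G' \<turnstile> zero_exists"
          unfolding zero_exists_def by (intro Ex_Nat_witness[of _ ?n]) (simp add: inst_def)
        ultimately show "?G' \<turnstile> ?B"
          by (intro OrI1 AndI)
      next
        let ?G' = "(?w =\<^sub>Q Q1) # ?G"
        \<comment> \<open>With w = 1 and y = 5 both summands vanish, and the sum equals y w -
          5.\<close>
        have "Zer ?G' ((ev ?w - ev Q1) * ev ?y + (ev ?y - ev Q5))"
          by (intro Zer_add Zer_mult QEq_Assm) simp_all
        then have "?G' \<turnstile> ?y' =\<^sub>Q Q5"
          by (simp add: QEq_iff_Zer ev_jump algebra_simps)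
        then show "?G' \<turnstile> ?B"
          by (rule OrI2)
      qed
    qed simp
    then show "[?A] \<turnstile> inst_Succ ?A"
      by (simp add: inst_Succ_def weaken_sub_def weaken_def)
  qed
  then show ?thesis
    by (simp add: inst_def)
qed

lemma qinv_2_double: "r * qinv (1 + 1) + r * qinv (1 + 1) = r"
proof -
  have "r * ((1 + 1) * qinv (1 + 1)) = r"
    by (simp add: mult_qinv Pos_add Pos_1)
  then show ?thesis
    by (simp add: algebra_simps)
qed

text \<open>The strict bound 2 leaves room for the initial value 1. In the step, with h' = h/2, the
  identity 2 - h' = (2 - h) + h' uses the lower bound to carry the upper one.\<close>

lemma halves_bounds:
  "Pos \<Gamma> (ev (QApp halves t)) \<and> Pos \<Gamma> (1 + 1 - ev (QApp halves t))"
proof -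
  let ?h = "QApp halves (NVar 0)" and ?h' = "QApp halves (Succ (NVar 0))"
  let ?A = "Q0 <\<^sub>Q ?h \<^bold>\<and> ?h <\<^sub>Q Q2"
  have "\<Gamma> \<turnstile> inst (NObj t) ?A"
  proof (rule induct_Nat)
    show "[] \<turnstile> inst (NObj Zero) ?A"
      by (auto simp: inst_def ev_halves QLess_iff_Pos Pos_1 intro!: AndI)
    have "[?A] \<turnstile> Q0 <\<^sub>Q ?h" "[?A] \<turnstile> ?h <\<^sub>Q Q2"
      by (rule AndE1[OF Assm] AndE2[OF Assm], simp)+
    then have pos: "Pos [?A] (ev ?h)" and less: "Pos [?A] (1 + 1 - ev ?h)"
      by (simp_all add: QLess_iff_Pos)
    from pos have pos': "Pos [?A] (ev ?h')"
      by (simp add: ev_halves Pos_mult Pos_qinv Pos_add Pos_1)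
    have half: "ev ?h = ev ?h' + ev ?h'"
      by (simp add: ev_halves qinv_2_double)
    have "1 + 1 - ev ?h + ev ?h' = 1 + 1 - ev ?h'"
      unfolding half by (simp add: algebra_simps)
    with Pos_add[OF less pos'] have "Pos [?A] (1 + 1 - ev ?h')"
      by simp
    with pos' show "[?A] \<turnstile> inst_Succ ?A"
      by (auto simp: inst_Succ_def QLess_iff_Pos intro!: AndI)
  qed
  then have "\<Gamma> \<turnstile> Q0 <\<^sub>Q QApp halves t \<^bold>\<and> QApp halves t <\<^sub>Q Q2"
    by (simp add: inst_def)
  from AndE1[OF this] AndE2[OF this] show ?thesis
    by (simp add: QLess_iff_Pos)
qed

text \<open>With y, h and w as below, the increment is (h - h/2) + (y - y w). The first part is
  positive; the second is 0, or 5 at the drop.\<close>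

lemma alpha_increasing: "\<Gamma> \<turnstile> QApp alpha t <\<^sub>Q QApp alpha (Succ t)"
proof -
  let ?y = "ev (QApp jump t)" and ?h = "ev (QApp halves t)"
    and ?W = "QApp sgn_seq (NApp (NSVar 0) t)"
  let ?w = "ev ?W"
  have half: "Pos \<Delta> (?h - ?h * qinv (1 + 1))" for \<Delta>
  proof -
    have "?h - ?h * qinv (1 + 1) = ?h * qinv (1 + 1)"
      using qinv_2_double[of ?h] by (metis add_diff_cancel_right')
    then show ?thesis
      using halves_bounds[of \<Delta> t] by (simp add: Pos_mult Pos_qinv Pos_add Pos_1)
  qed
  \<comment> \<open>Covers the two cases without a drop: y = 0, and w = 1.\<close>
  have *: "\<Delta> \<turnstile> QApp alpha t <\<^sub>Q QApp alpha (Succ t)" if "Zer \<Delta> (?y - ?y * ?w)" for \<Delta>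
    using Pos_add_Zer[OF half that] by (simp add: QLess_iff_Pos ev_alpha ev_jump ev_halves algebra_simps)
  show ?thesis
  proof (rule OrE[OF jump_cases[of _ t]])
    let ?G = "(QApp jump t =\<^sub>Q Q0 \<^bold>\<and> zero_exists) # \<Gamma>"
    have "?G \<turnstile> QApp jump t =\<^sub>Q Q0"
      by (rule AndE1[where B = zero_exists]) (simp add: Assm)
    then have "Zer ?G (?y * (1 - ?w))"
      by (intro Zer_mult) (simp add: QEq_iff_Zer)
    then show "?G \<turnstile> QApp alpha t <\<^sub>Q QApp alpha (Succ t)"
      by (intro *) (simp add: algebra_simps)
  next
    let ?G = "(QApp jump t =\<^sub>Q Q5) # \<Gamma>"
    show "?G \<turnstile> QApp alpha t <\<^sub>Q QApp alpha (Succ t)"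
    proof (rule OrE[OF sgn_seq_cases[of _ "NApp (NSVar 0) t"]])
      let ?G' = "(NApp (NSVar 0) t =\<^sub>N Zero \<^bold>\<and> ?W =\<^sub>Q Q0) # ?G"
      have "?G' \<turnstile> ?W =\<^sub>Q Q0"
        by (rule AndE2[where A = "NApp (NSVar 0) t =\<^sub>N Zero"]) (simp add: Assm)
      then have w: "Zer ?G' (?w * (- ?y))"
        by (intro Zer_mult) (simp add: QEq_iff_Zer)
      have y: "Zer ?G' (?y - ev Q5)"
        by (intro QEq_Assm) simp
      have "Pos ?G' (?h - ?h * qinv (1 + 1) + ev Q5)"
        by (simp add: Pos_add half Pos_1)
      from Pos_add_Zer[OF Pos_add_Zer[OF this w] y]
      show "?G' \<turnstile> QApp alpha t <\<^sub>Q QApp alpha (Succ t)"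
        by (simp add: QLess_iff_Pos ev_alpha ev_jump ev_halves algebra_simps)
    next
      let ?G' = "(?W =\<^sub>Q Q1) # ?G"
      have "Zer ?G' ((?w - ev Q1) * (- ?y))"
        by (intro Zer_mult QEq_Assm) simp
      then show "?G' \<turnstile> QApp alpha t <\<^sub>Q QApp alpha (Succ t)"
        by (intro *) (simp add: algebra_simps)
    qed
  qed
qed

lemma alpha_negative: "\<Gamma> \<turnstile> QApp alpha t <\<^sub>Q Q0"
proof (rule OrE[OF jump_cases[of _ t]])
  let ?G = "(QApp jump t =\<^sub>Q Q0 \<^bold>\<and> zero_exists) # \<Gamma>"
  have "?G \<turnstile> QApp jump t =\<^sub>Q Q0"
    by (rule AndE1[where B = zero_exists]) (simp add: Assm)
  then show "?G \<turnstile> QApp alpha t <\<^sub>Q Q0"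
    using Pos_add_Zer[of ?G "ev (QApp halves t)" "ev (QApp jump t)"] halves_bounds[of ?G t]
    by (simp add: QLess_iff_Pos QEq_iff_Zer ev_alpha add.commute)
next
  let ?G = "(QApp jump t =\<^sub>Q Q5) # \<Gamma>"
  have "Pos ?G (ev (QApp halves t) + ev Q5)"
    using halves_bounds[of ?G t] by (simp add: Pos_add Pos_1)
  moreover have "Zer ?G (ev (QApp jump t) - ev Q5)"
    by (intro QEq_Assm) simp
  ultimately show "?G \<turnstile> QApp alpha t <\<^sub>Q Q0"
    using Pos_add_Zer by (fastforce simp: QLess_iff_Pos ev_alpha algebra_simps)
qed

lemma oriented_real_alpha: "\<Gamma> \<turnstile> oriented_real alpha"
proof -
  let ?C = "\<lambda>x. All Nat (QApp alpha (NVar 0) <\<^sub>Q QApp alpha (Succ (NVar 0)) \<^bold>\<and>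
                      QApp alpha (Succ (NVar 0)) <\<^sub>Q x)"
  \<comment> \<open>By \<open>alpha_negative\<close>, 0 serves as the bound M.\<close>
  have "\<Gamma> \<turnstile> inst (QObj Q0) (?C (QVar 0))"
    by (simp add: inst_def up_sub_def weaken_sub_def weaken_def AllI AndI alpha_increasing alpha_negative)
  then show ?thesis
    using ExI[of \<Gamma> "QObj Q0" "?C (QVar 0)"] by (simp add: oriented_real_def weaken_def)
qed

section \<open>Deciding the existence of a zero\<close>

text \<open>The free \<open>QVar 0\<close> is the approximating rational q, here and below.\<close>

definition q_le_alpha :: fm where
  "q_le_alpha = (hat (QVar 0) \<le>\<^sub>o alpha)"

text \<open>The upper bound at precision n = 0, where \<open>QInv (pow2 Zero)\<close> equals
  1.\<close>

definition alpha_le_q_plus_1 :: fm where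
  "alpha_le_q_plus_1 = (alpha \<le>\<^sub>o hat (QAdd (QVar 0) (QInv (pow2 Zero))))"

lemma ren_bounds [simp]:
  "ren_fm (weaken Nat) q_le_alpha = q_le_alpha" "ren_fm (weaken Nat) alpha_le_q_plus_1 = alpha_le_q_plus_1"
  by (simp_all add: q_le_alpha_def alpha_le_q_plus_1_def le_def hat_def pow2_def up_ren_def weaken_def)

lemma approximable_alpha_elim:
  assumes "\<Gamma> \<turnstile> approximable alpha"
  shows "\<Gamma> \<turnstile> Ex Rat (q_le_alpha \<^bold>\<and> alpha_le_q_plus_1)"
  using All_Nat_inst[OF assms[unfolded approximable_def Let_def], of Zero]
  by (simp add: inst_def q_le_alpha_def alpha_le_q_plus_1_def le_def hat_def pow2_def
      up_sub_def weaken_sub_def weaken_def up_ren_def numeral_eq_Suc)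

text \<open>Index 0 is chosen, where \<open>hat\<close> of q takes the value q - 1.\<close>

lemma q_le_alpha_elim:
  assumes "q_le_alpha \<in> set \<Gamma>"
  shows "\<Gamma> \<turnstile> Ex Nat (QApp (hat (QVar 0)) Zero <\<^sub>Q QApp alpha (NVar 0))"
proof -
  have "\<Gamma> \<turnstile> q_le_alpha"
    using assms by (rule Assm)
  from All_Nat_inst[OF this[unfolded q_le_alpha_def le_def], of Zero] show ?thesis
    by (simp add: inst_def hat_def up_sub_def weaken_sub_def weaken_def up_ren_def)
qed

text \<open>Under the quantifier \<open>NVar 1\<close> is the outer \<open>NVar 0\<close>, later a
  zero of \<open>a\<close>. The successor is taken because \<open>jump\<close> reacts to that zero
  one index later.\<close>

lemma alpha_le_q_plus_1_elim:
  assumes "alpha_le_q_plus_1 \<in> set \<Gamma>"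
  shows "\<Gamma> \<turnstile> Ex Nat (QApp alpha (Succ (NVar 1)) <\<^sub>Q QApp (hat (QAdd (QVar 0) (QInv (pow2 Zero)))) (NVar 0))"
proof -
  have "\<Gamma> \<turnstile> alpha_le_q_plus_1"
    using assms by (rule Assm)
  from All_Nat_inst[OF this[unfolded alpha_le_q_plus_1_def le_def], of "Succ (NVar 0)"] show ?thesis
    by (simp add: inst_def hat_def pow2_def up_sub_def weaken_sub_def weaken_def up_ren_def)
qed

lemma ev_hat:
  "ev (QApp (hat (QVar 0)) t) = ev (QVar 0) - qinv (ev (QOf t) + 1)"
  "ev (QApp (hat (QAdd (QVar 0) (QInv (pow2 Zero)))) t) = ev (QVar 0) + 1 - qinv (ev (QOf t) + 1)"
  by (simp_all add: hat_def pow2_def ev_QLam ev_QRec_Zero weaken_def)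

lemma zero_exists_if_large:
  "[QNeg Q4 <\<^sub>Q QVar 0, q_le_alpha] \<turnstile> zero_exists"
proof (rule ExE[OF q_le_alpha_elim])
  let ?n = "NVar 0"
  let ?A = "QApp (hat (QVar 0)) Zero <\<^sub>Q QApp alpha ?n"
  let ?G = "[?A, QNeg Q4 <\<^sub>Q QVar 0, q_le_alpha]"
  have "?G \<turnstile> zero_exists"
  proof (rule OrE[OF jump_cases[of _ ?n]])
    let ?G' = "(QApp jump ?n =\<^sub>Q Q0 \<^bold>\<and> zero_exists) # ?G"
    show "?G' \<turnstile> zero_exists"
      by (rule AndE2[where A = "QApp jump ?n =\<^sub>Q Q0"]) (simp add: Assm)
  next
    let ?G' = "(QApp jump ?n =\<^sub>Q Q5) # ?G"
    have 1: "Pos ?G' (ev (QApp alpha ?n) - ev (QApp (hat (QVar 0)) Zero))"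
      by (rule QLess_Assm) simp
    have 2: "Pos ?G' (ev (QVar 0) - ev (QNeg Q4))"
      by (rule QLess_Assm) simp
    have 3: "Zer ?G' (ev (QApp jump ?n) - ev Q5)"
      by (rule QEq_Assm) simp
    have 4: "Pos ?G' (ev (QApp halves ?n))"
      by (simp add: halves_bounds)
    \<comment> \<open>If y(n) = 5, then alpha(n) = -5 - h < -5, against alpha(n) > q - 1 > -5; the
      sum of these facts is 0.\<close>
    from Pos_add_Zer[OF Pos_add[OF Pos_add[OF 1 2] 4] 3] have "Pos ?G' 0"
      by (simp add: ev_alpha ev_hat algebra_simps)
    then show "?G' \<turnstile> zero_exists"
      by (rule Pos_0)
  qed
  then show "?A # map (ren_fm (weaken Nat)) [QNeg Q4 <\<^sub>Q QVar 0, q_le_alpha]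
      \<turnstile> ren_fm (weaken Nat) zero_exists"
    by simp
qed simp

lemma no_zero_if_small:
  "[QVar 0 <\<^sub>Q QNeg Q3, alpha_le_q_plus_1] \<turnstile> \<^bold>\<not> zero_exists"
proof (rule ImpI)
  let ?D = "[QVar 0 <\<^sub>Q QNeg Q3, alpha_le_q_plus_1]"
  let ?Z = "\<lambda>t. NApp (NSVar 0) t =\<^sub>N Zero"
  let ?A = "QApp alpha (Succ (NVar 1)) <\<^sub>Q QApp (hat (QAdd (QVar 0) (QInv (pow2 Zero)))) (NVar 0)"
  \<comment> \<open>\<open>NVar 1\<close> is the zero k of \<open>a\<close>, and
    \<open>NVar 0\<close> the index m at which \<open>hat\<close> exceeds alpha(k+1).\<close>
  let ?G = "?A # ?Z (NVar 1) # zero_exists # ?D"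
  have "?G \<turnstile> \<^bold>\<bottom>"
  proof -
    let ?h = "QApp halves (Succ (NVar 1))"
      and ?W = "QApp sgn_seq (NApp (NSVar 0) (NVar 1))"
    have 1: "Pos ?G (ev (QApp (hat (QAdd (QVar 0) (QInv (pow2 Zero)))) (NVar 0))
        - ev (QApp alpha (Succ (NVar 1))))"
      by (rule QLess_Assm) simp
    have 2: "Pos ?G (ev (QNeg Q3) - ev (QVar 0))"
      by (rule QLess_Assm) simp
    have 3: "Pos ?G (1 + 1 - ev ?h)"
      by (simp add: halves_bounds)
    have 4: "Pos ?G (qinv (ev (QOf (NVar 0)) + 1))"
      by (rule Pos_qinv[OF Pos_QOf_Succ])
    have "?G \<turnstile> ?Z (NVar 1)"
      by (simp add: Assm)
    then have "?G \<turnstile> ?W =\<^sub>Q QApp sgn_seq Zero"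
      by (rule QApp_cong)
    then have 5: "Zer ?G (ev ?W * - ev (QApp jump (NVar 1)))"
      by (intro Zer_mult) (simp add: QEq_iff_Zer ev_sgn_seq)
    \<comment> \<open>As y(k+1) = 0, alpha(k+1) = -h > -2, against alpha(k+1) < q + 1 - 1/(m+1) <
      -2; again everything cancels.\<close>
    from Pos_add_Zer[OF Pos_add[OF Pos_add[OF Pos_add[OF 1 2] 3] 4] 5] have "Pos ?G 0"
      by (simp add: ev_alpha ev_hat ev_jump algebra_simps)
    then show ?thesis
      by (rule Pos_0)
  qed
  then have "?Z (NVar 0) # zero_exists # ?D \<turnstile> \<^bold>\<bottom>"
    by - (rule ExE[OF alpha_le_q_plus_1_elim], simp_all)
  then show "zero_exists # ?D \<turnstile> \<^bold>\<bottom>"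
    by - (rule ExE[OF Assm, of Nat "?Z (NVar 0)"], simp_all flip: zero_exists_def)
qed

text \<open>Compare q with -3. The cases q = -3 and q > -3 both give q > -4, so
  \<open>zero_exists_if_large\<close> handles them together.\<close>

lemma zero_exists_decided: "[q_le_alpha \<^bold>\<and> alpha_le_q_plus_1] \<turnstile> zero_exists \<^bold>\<or> \<^bold>\<not> zero_exists"
proof -
  let ?G = "[alpha_le_q_plus_1, q_le_alpha, q_le_alpha \<^bold>\<and> alpha_le_q_plus_1]"
  have large: "A # ?G \<turnstile> zero_exists \<^bold>\<or> \<^bold>\<not> zero_exists"
    if "A # ?G \<turnstile> QNeg Q4 <\<^sub>Q QVar 0" for A
    by (rule OrI1, rule cut[OF that], rule weakening[OF zero_exists_if_large]) auto
  have "?G \<turnstile> zero_exists \<^bold>\<or> \<^bold>\<not> zero_exists"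
  proof (rule trichotomy[of "QVar 0" "QNeg Q3"])
    show "(QVar 0 <\<^sub>Q QNeg Q3) # ?G \<turnstile> zero_exists \<^bold>\<or> \<^bold>\<not> zero_exists"
      by (rule OrI2, rule weakening[OF no_zero_if_small]) auto
    have less: "\<Gamma> \<turnstile> QNeg Q4 <\<^sub>Q QNeg Q3" for \<Gamma>
      by (simp add: QLess_iff_Pos Pos_1)
    show "(QNeg Q3 <\<^sub>Q QVar 0) # ?G \<turnstile> zero_exists \<^bold>\<or> \<^bold>\<not> zero_exists"
      by (rule large, rule QLess_trans[OF less Assm]) simp
    have "(QVar 0 =\<^sub>Q QNeg Q3) # ?G \<turnstile> QVar 0 =\<^sub>Q QNeg Q3"
      by (simp add: Assm)
    then show "(QVar 0 =\<^sub>Q QNeg Q3) # ?G \<turnstile> zero_exists \<^bold>\<or> \<^bold>\<not> zero_exists"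
      by (intro large QLess_cong[OF QEq_refl QEq_sym less])
  qed
  then have "[q_le_alpha, q_le_alpha \<^bold>\<and> alpha_le_q_plus_1] \<turnstile> zero_exists \<^bold>\<or> \<^bold>\<not> zero_exists"
    by (rule cut[OF AndE2[where A = q_le_alpha], rotated]) (simp add: Assm)
  then show ?thesis
    by (rule cut[OF AndE1[where B = alpha_le_q_plus_1], rotated]) (simp add: Assm)
qed

theorem proposition2p15:
  shows "[\<^bold>\<not> ex_PEM] \<turnstile>
    \<^bold>\<not> All RatSeq (oriented_real (QSVar 0) \<^bold>\<longrightarrow> approximable (QSVar 0))"
proof (rule ImpI)
  let ?H = "All RatSeq (oriented_real (QSVar 0) \<^bold>\<longrightarrow> approximable (QSVar 0))"
  \<comment> \<open>\<open>alpha\<close> contains \<open>NSVar 0\<close> free, so the argument runs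
    for an arbitrary sequence \<open>a\<close>.\<close>
  have "[?H] \<turnstile> inst (QSObj alpha) (oriented_real (QSVar 0) \<^bold>\<longrightarrow> approximable (QSVar 0))"
    by (rule AllE) (simp add: Assm)
  then have "[?H] \<turnstile> oriented_real alpha \<^bold>\<longrightarrow> approximable alpha"
    by (simp add: inst_def Let_def oriented_real_def approximable_def le_def hat_def pow2_def
        up_sub_def weaken_sub_def weaken_def up_ren_def)
  then have "[?H] \<turnstile> approximable alpha"
    using oriented_real_alpha by (rule ImpE)
  then have "[?H] \<turnstile> Ex Rat (q_le_alpha \<^bold>\<and> alpha_le_q_plus_1)"
    by (rule approximable_alpha_elim)
  then have "[?H] \<turnstile> zero_exists \<^bold>\<or> \<^bold>\<not> zero_exists"
    by (rule ExE) (simp add: weakening[OF zero_exists_decided])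
  \<comment> \<open>\<open>?H\<close> is closed, so the rule \<open>AllI\<close> may generalise over
    \<open>a\<close> under this assumption.\<close>
  moreover have "ren_fm (weaken NatSeq) ?H = ?H"
    by (simp add: Let_def oriented_real_def approximable_def le_def hat_def pow2_def weaken_def up_ren_def)
  ultimately have "[?H] \<turnstile> ex_PEM"
    by (simp add: ex_PEM_def AllI flip: zero_exists_def)
  then have "[?H, \<^bold>\<not> ex_PEM] \<turnstile> ex_PEM"
    by (rule weakening) simp
  then show "[?H, \<^bold>\<not> ex_PEM] \<turnstile> \<^bold>\<bottom>"
    by (rule ImpE[OF Assm, rotated]) simp
qed

end
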